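(* Let $\mathcal G=(G_n,\|\cdot\|_n)_{n\in\mathbb N}$ be a family of metric groups with $\sup\{\|g\|_n : n\in\mathbb N,\ g\in G_n\}<\infty$, let $\mathcal U$ be a non-principal ultrafilter on $\mathbb N$, and fix $\varepsilon>0$. If $\mathcal G^*_{\mathrm{met}}$ is $\varepsilon$-torsion, then $\mathcal G^*_{\mathrm{met}}$ is almost uniformly $2\varepsilon$-torsion.
   Context: A metric group $(G,\|\cdot\|)$ is a group with a bi-invariant norm $\|\cdot\|\colon G\to[0,\infty]$: $\|e\|=0$, $\|gh\|\le\|g\|+\|h\|$, $\|g^{-1}\|=\|g\|=\|hgh^{-1}\|$, and $\|g\|=0$ iff $g=e$. The metric ultraproduct is $\mathcal G^*_{\mathrm{met}}=\prod_{n}G_n/\mathcal E$, where $\mathcal E=\{(g_n)\in\prod_n G_n : \lim_{n\to\mathcal U}\|g_n\|_n=0\}$, with norm $\|(g_n)/\mathcal E\|=\lim_{n\to\mathcal U}\|g_n\|_n$. For $\delta>0$, a metric group $(G,\|\cdot\|)$ is $\delta$-torsion if for every $g\in G$ there is an integer $N\ge1$ with $\|g^N\|<\delta$; it is almost uniformly $\delta$-torsion if there is an integer $N\ge1$ such that for every $g\in G$ there is $1\le m\le N$ with $\|g^m\|<\delta$. *)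

theory Defs
  imports "HOL-Analysis.Analysis" "HOL-Algebra.Product_Groups"
begin

locale metric_group = group G for G (structure) +
  fixes nm :: "'a \<Rightarrow> ennreal"
  assumes norm_one: "nm \<one> = 0"
    and norm_mult: "\<lbrakk>g \<in> carrier G; h \<in> carrier G\<rbrakk> \<Longrightarrow> nm (g \<otimes> h) \<le> nm g + nm h"
    and norm_inv: "g \<in> carrier G \<Longrightarrow> nm (inv g) = nm g"
    and norm_conj: "\<lbrakk>g \<in> carrier G; h \<in> carrier G\<rbrakk> \<Longrightarrow> nm (h \<otimes> g \<otimes> inv h) = nm g"
    and norm_eq_0_iff: "g \<in> carrier G \<Longrightarrow> nm g = 0 \<longleftrightarrow> g = \<one>"

definition ultrafilter :: "'i filter \<Rightarrow> bool" where
  "ultrafilter U \<longleftrightarrow>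
     U \<noteq> bot \<and> (\<forall>P. eventually P U \<or> eventually (\<lambda>i. \<not> P i) U)"

definition nonprincipal_ultrafilter :: "'i filter \<Rightarrow> bool" where
  "nonprincipal_ultrafilter U \<longleftrightarrow> ultrafilter U \<and> (\<forall>i. U \<noteq> principal {i})"

definition null_seqs ::
  "('i \<Rightarrow> ('a, 'b) monoid_scheme) \<Rightarrow> ('i \<Rightarrow> 'a \<Rightarrow> ennreal) \<Rightarrow> 'i filter \<Rightarrow> ('i \<Rightarrow> 'a) set" where
  "null_seqs G nm U =
     {g \<in> carrier (product_group UNIV G). ((\<lambda>i. nm i (g i)) \<longlongrightarrow> 0) U}"

definition met_ultraproduct ::
  "('i \<Rightarrow> ('a, 'b) monoid_scheme) \<Rightarrow> ('i \<Rightarrow> 'a \<Rightarrow> ennreal) \<Rightarrow> 'i filter \<Rightarrow> ('i \<Rightarrow> 'a) set monoid" where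
  "met_ultraproduct G nm U = product_group UNIV G Mod null_seqs G nm U"

text \<open>The norm of a coset is the limit along the filter of the norms of any of its
  representatives; that it exists and does not depend on the representative is shown
  in \<open>met_ultranorm_coset\<close> below.\<close>

definition met_ultranorm ::
  "('i \<Rightarrow> 'a \<Rightarrow> ennreal) \<Rightarrow> 'i filter \<Rightarrow> ('i \<Rightarrow> 'a) set \<Rightarrow> ennreal" where
  "met_ultranorm nm U X = (THE l. \<forall>g\<in>X. ((\<lambda>i. nm i (g i)) \<longlongrightarrow> l) U)"

definition torsion_upto ::
  "real \<Rightarrow> ('a, 'b) monoid_scheme \<Rightarrow> ('a \<Rightarrow> ennreal) \<Rightarrow> bool" where
  "torsion_upto \<delta> G nm \<longleftrightarrow>
     (\<forall>g\<in>carrier G. \<exists>N::nat. 1 \<le> N \<and> nm (g [^]\<^bsub>G\<^esub> N) < ennreal \<delta>)"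

definition almost_uniformly_torsion_upto ::
  "real \<Rightarrow> ('a, 'b) monoid_scheme \<Rightarrow> ('a \<Rightarrow> ennreal) \<Rightarrow> bool" where
  "almost_uniformly_torsion_upto \<delta> G nm \<longleftrightarrow>
     (\<exists>N::nat. 1 \<le> N \<and>
        (\<forall>g\<in>carrier G. \<exists>m::nat. 1 \<le> m \<and> m \<le> N \<and> nm (g [^]\<^bsub>G\<^esub> m) < ennreal \<delta>))"

lemma ultrafilter_tendsto_ex:
  fixes f :: "'i \<Rightarrow> ennreal"
  assumes "ultrafilter U"
  shows "\<exists>l. (f \<longlongrightarrow> l) U"
proof -
  have nb: "U \<noteq> bot" and ul: "\<And>P. eventually P U \<or> eventually (\<lambda>i. \<not> P i) U"
    using assms by (auto simp: ultrafilter_def)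
  define l where "l = Sup {a. eventually (\<lambda>i. a \<le> f i) U}"
  have "(f \<longlongrightarrow> l) U"
  proof (rule order_tendstoI)
    fix a assume "a < l"
    then obtain b where "eventually (\<lambda>i. b \<le> f i) U" "a < b"
      by (auto simp: l_def less_Sup_iff)
    then show "eventually (\<lambda>i. a < f i) U" by (auto elim: eventually_mono)
  next
    fix a assume "l < a"
    then have "\<not> eventually (\<lambda>i. a \<le> f i) U"
      by (metis Sup_upper l_def mem_Collect_eq not_less)
    then show "eventually (\<lambda>i. f i < a) U" using ul[of "\<lambda>i. a \<le> f i"] by (simp add: not_le)
  qed
  then show ?thesis ..
qed

locale metric_group_family =
  fixes G :: "'i \<Rightarrow> ('a, 'b) monoid_scheme" and nm :: "'i \<Rightarrow> 'a \<Rightarrow> ennreal"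
    and U :: "'i filter"
  assumes mg: "\<And>i. metric_group (G i) (nm i)" and uf: "ultrafilter U"
begin

abbreviation "P \<equiv> product_group UNIV G"

lemma grp: "group (G i)"
  using mg metric_group.axioms(1) by blast

lemma group_P: "group P"
  by (simp add: grp)

lemma inv_P: "x \<in> carrier P \<Longrightarrow> inv\<^bsub>P\<^esub> x = (\<lambda>i. inv\<^bsub>G i\<^esub> x i)"
  using inv_product_group[of x UNIV G] grp by auto

lemma null_normal: "null_seqs G nm U \<lhd> P"
proof -
  have pos: "eventually (\<lambda>i. (0::ennreal) \<le> f i) U" for f by simp
  interpret P: group P by (rule group_P)
  have "subgroup (null_seqs G nm U) P"
  proof (rule P.subgroupI)
    show "null_seqs G nm U \<subseteq> carrier P" by (auto simp: null_seqs_def)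
    have "\<one>\<^bsub>P\<^esub> \<in> null_seqs G nm U"
      using P.one_closed by (simp add: null_seqs_def metric_group.norm_one[OF mg])
    then show "null_seqs G nm U \<noteq> {}" by blast
  next
    fix x assume x: "x \<in> null_seqs G nm U"
    then have xc: "x \<in> carrier P" by (simp add: null_seqs_def)
    then have "nm i (inv\<^bsub>G i\<^esub> x i) = nm i (x i)" for i
      using metric_group.norm_inv[OF mg] by auto
    then show "inv\<^bsub>P\<^esub> x \<in> null_seqs G nm U"
      using x P.inv_closed[OF xc] by (simp add: null_seqs_def inv_P[OF xc])
  next
    fix x y assume x: "x \<in> null_seqs G nm U" and y: "y \<in> null_seqs G nm U"
    then have c: "x \<in> carrier P" "y \<in> carrier P" by (auto simp: null_seqs_def)
    have "((\<lambda>i. nm i (x i) + nm i (y i)) \<longlongrightarrow> 0 + 0) U"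
      using x y by (intro tendsto_add) (auto simp: null_seqs_def)
    then have s: "((\<lambda>i. nm i (x i) + nm i (y i)) \<longlongrightarrow> 0) U" by simp
    have le: "nm i (x i \<otimes>\<^bsub>G i\<^esub> y i) \<le> nm i (x i) + nm i (y i)" for i
      using metric_group.norm_mult[OF mg, of "x i" i "y i"] c by auto
    have "((\<lambda>i. nm i (x i \<otimes>\<^bsub>G i\<^esub> y i)) \<longlongrightarrow> 0) U"
      by (rule tendsto_sandwich[OF pos always_eventually[OF allI[OF le]] tendsto_const s])
    then show "x \<otimes>\<^bsub>P\<^esub> y \<in> null_seqs G nm U"
      using P.m_closed[OF c] by (simp add: null_seqs_def)
  qed
  moreover have "y \<otimes>\<^bsub>P\<^esub> x \<otimes>\<^bsub>P\<^esub> inv\<^bsub>P\<^esub> y \<in> null_seqs G nm U"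
    if y: "y \<in> carrier P" and x: "x \<in> null_seqs G nm U" for x y
  proof -
    have xc: "x \<in> carrier P" using x by (simp add: null_seqs_def)
    have e: "nm i (y i \<otimes>\<^bsub>G i\<^esub> x i \<otimes>\<^bsub>G i\<^esub> inv\<^bsub>G i\<^esub> y i) = nm i (x i)" for i
      using metric_group.norm_conj[OF mg, of "x i" i "y i"] xc y by auto
    have "y \<otimes>\<^bsub>P\<^esub> x \<otimes>\<^bsub>P\<^esub> inv\<^bsub>P\<^esub> y \<in> carrier P" using xc y by blast
    then show ?thesis
      using x e by (simp add: null_seqs_def inv_P[OF y])
  qed
  ultimately show ?thesis by (simp add: P.normal_inv_iff)
qed

lemma met_ultranorm_coset:
  assumes g: "g \<in> carrier P"
  shows "((\<lambda>i. nm i (g i)) \<longlongrightarrow> met_ultranorm nm U (null_seqs G nm U #>\<^bsub>P\<^esub> g)) U"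
proof -
  let ?X = "null_seqs G nm U #>\<^bsub>P\<^esub> g"
  interpret P: group P by (rule group_P)
  interpret N: normal "null_seqs G nm U" P by (rule null_normal)
  obtain l where l: "((\<lambda>i. nm i (g i)) \<longlongrightarrow> l) U"
    using ultrafilter_tendsto_ex[OF uf] by blast
  have all: "((\<lambda>i. nm i (x i)) \<longlongrightarrow> l) U" if xX: "x \<in> ?X" for x
  proof -
    obtain h where h: "h \<in> null_seqs G nm U" and x: "x = h \<otimes>\<^bsub>P\<^esub> g"
      using xX by (auto simp: r_coset_def)
    have c: "h i \<in> carrier (G i)" "g i \<in> carrier (G i)" for i
      using h g by (auto simp: null_seqs_def)
    have xi: "x i = h i \<otimes>\<^bsub>G i\<^esub> g i" for i by (simp add: x)
    have h0: "((\<lambda>i. nm i (h i)) \<longlongrightarrow> 0) U" using h by (simp add: null_seqs_def)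
    obtain l' where l': "((\<lambda>i. nm i (x i)) \<longlongrightarrow> l') U"
      using ultrafilter_tendsto_ex[OF uf] by blast
    have nb: "U \<noteq> bot" using uf by (simp add: ultrafilter_def)
    have a: "nm i (x i) \<le> nm i (h i) + nm i (g i)" for i
      using metric_group.norm_mult[OF mg, of "h i" i "g i"] c by (simp add: xi)
    have b: "nm i (g i) \<le> nm i (h i) + nm i (x i)" for i
    proof -
      interpret Gi: metric_group "G i" "nm i" by (rule mg)
      have "g i = inv\<^bsub>G i\<^esub> h i \<otimes>\<^bsub>G i\<^esub> x i"
        using c by (simp add: xi flip: Gi.m_assoc)
      then show ?thesis
        using Gi.norm_mult[of "inv\<^bsub>G i\<^esub> h i" "x i"] Gi.norm_inv[of "h i"] c by (simp add: xi)
    qed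
    have "l' \<le> 0 + l"
      by (rule tendsto_le[OF nb tendsto_add[OF h0 l] l']) (use a in simp)
    moreover have "l \<le> 0 + l'"
      by (rule tendsto_le[OF nb tendsto_add[OF h0 l'] l]) (use b in simp)
    ultimately show ?thesis using l' by simp
  qed
  have gX: "g \<in> ?X" using P.rcos_self[OF g N.subgroup_axioms] .
  have nb: "U \<noteq> bot" using uf by (simp add: ultrafilter_def)
  have "met_ultranorm nm U ?X = l"
    unfolding met_ultranorm_def
  proof (rule the_equality)
    fix k assume "\<forall>x\<in>?X. ((\<lambda>i. nm i (x i)) \<longlongrightarrow> k) U"
    then show "k = l" using gX by (intro tendsto_unique[OF nb _ l]) blast
  qed (use all in blast)
  then show ?thesis using l by simp
qed

end

end

theory Submission
  imports Defs
begin

text \<open>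
  If the conclusion fails, then for every \<open>N\<close> some element of the ultraproduct has its first \<open>N\<close>
  powers of norm at least \<open>2 * \<epsilon>\<close>, so for \<open>U\<close>-many \<open>n\<close> some element of \<open>G n\<close> has its first \<open>N\<close>
  powers of norm at least \<open>\<epsilon>\<close>. Countable saturation along the non-principal \<open>U\<close> merges these into
  a single sequence all of whose powers have ultraproduct norm at least \<open>\<epsilon>\<close>, contradicting
  \<open>\<epsilon>\<close>-torsion.
\<close>

text \<open>Otherwise the ultrafilter contains the singleton of \<open>a\<close>, so a property
  holds eventually exactly when it holds at \<open>a\<close>, which makes \<open>U\<close>
  principal.\<close>

lemma nonprincipal_ultrafilter_eventually_neq:
  assumes "nonprincipal_ultrafilter U"
  shows "eventually (\<lambda>i. i \<noteq> a) U"
proof (rule ccontr)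
  assume "\<not> ?thesis"
  with assms have ev: "eventually (\<lambda>i. i = a) U" and nb: "U \<noteq> bot"
    by (auto simp: nonprincipal_ultrafilter_def ultrafilter_def)
  have "eventually P U \<longleftrightarrow> P a" for P
  proof
    assume "eventually P U"
    with ev have "eventually (\<lambda>i. P a) U" by eventually_elim simp
    then show "P a" using nb by (metis eventually_happens)
  qed (use ev in \<open>auto elim: eventually_mono\<close>)
  then have "U = principal {a}" by (simp add: filter_eq_iff eventually_principal)
  with assms show False by (simp add: nonprincipal_ultrafilter_def)
qed

lemma nonprincipal_ultrafilter_eventually_ge:
  fixes U :: "nat filter"
  assumes "nonprincipal_ultrafilter U"
  shows "eventually (\<lambda>n. N \<le> n) U"
proof -
  have "eventually (\<lambda>n. \<forall>a\<in>{..<N}. n \<noteq> a) U"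
    by (intro eventually_ball_finite ballI nonprincipal_ultrafilter_eventually_neq assms) simp
  then show ?thesis by (rule eventually_mono) (auto simp: not_less[symmetric])
qed

text \<open>Diagonal choice: \<open>x n\<close> satisfies as many of the initial conditions
  \<open>R 0 n\<close>, \<open>R 1 n\<close>, ... at once as index \<open>n\<close> permits, with
  the count capped at \<open>n\<close>.\<close>

lemma countable_saturation:
  fixes U :: "nat filter" and A :: "nat \<Rightarrow> 'a set"
    and R :: "nat \<Rightarrow> nat \<Rightarrow> 'a \<Rightarrow> bool"
  assumes ge: "\<And>N. eventually (\<lambda>n. N \<le> n) U"
    and ne: "\<And>n. A n \<noteq> {}"
    and fin: "\<And>N. eventually (\<lambda>n. \<exists>x\<in>A n. \<forall>m<N. R m n x) U"
  obtains x where "\<And>n. x n \<in> A n" "\<And>m. eventually (\<lambda>n. R m n (x n)) U"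
proof -
  \<comment> \<open>The cap \<open>N \<le> n\<close> keeps \<open>S n\<close> finite, so a maximum
    exists even when all conditions hold at once. For \<open>N = 0\<close> the conditions are
    vacuous, so indices with no good witness still receive some element of
    \<open>A n\<close>.\<close>
  define S where "S n = {N. N \<le> n \<and> (\<exists>x\<in>A n. \<forall>m<N. R m n x)}" for n
  have "finite (S n)" for n
    by (rule finite_subset[of _ "{..n}"]) (auto simp: S_def)
  moreover have "0 \<in> S n" for n
    using ne[of n] by (auto simp: S_def)
  ultimately have "Max (S n) \<in> S n" and le_Max: "N \<in> S n \<Longrightarrow> N \<le> Max (S n)" for n N
    by (auto intro!: Max_in Max_ge)
  then have "\<exists>x. x \<in> A n \<and> (\<forall>m<Max (S n). R m n x)" for n
    unfolding S_def by blast
  then obtain x where x: "\<And>n. x n \<in> A n" "\<And>n m. m < Max (S n) \<Longrightarrow> R m n (x n)"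
    by metis
  \<comment> \<open>Conditions are counted from 0, so reaching condition \<open>m\<close> takes an
    initial segment of length \<open>Suc m\<close>.\<close>
  have "eventually (\<lambda>n. R m n (x n)) U" for m
    using ge[of "Suc m"] fin[of "Suc m"]
  proof eventually_elim
    case (elim n)
    then have "Suc m \<in> S n" by (simp add: S_def)
    then show ?case using le_Max[of "Suc m" n] x(2)[of m n] by simp
  qed
  with x(1) show thesis by (rule that)
qed

lemma nat_pow_product_group:
  "x [^]\<^bsub>product_group UNIV G\<^esub> (m::nat) = (\<lambda>i. x i [^]\<^bsub>G i\<^esub> m)"
  by (induction m) auto

context metric_group_family
begin

lemma met_ultraproduct_carrierE:
  assumes "X \<in> carrier (met_ultraproduct G nm U)"
  obtains g where "g \<in> carrier P" "X = null_seqs G nm U #>\<^bsub>P\<^esub> g"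
  using assms by (auto simp: met_ultraproduct_def FactGroup_def RCOSETS_def)

lemma met_ultraproduct_carrierI:
  "g \<in> carrier P \<Longrightarrow> null_seqs G nm U #>\<^bsub>P\<^esub> g \<in> carrier (met_ultraproduct G nm U)"
  by (auto simp: met_ultraproduct_def FactGroup_def RCOSETS_def)

text \<open>Powers of a coset are taken on a representative, coordinate by coordinate. This
  transfers strict norm bounds from the ultraproduct to \<open>U\<close>-many coordinates.\<close>

lemma met_ultranorm_pow_tendsto:
  assumes "g \<in> carrier P"
  shows "((\<lambda>i. nm i (g i [^]\<^bsub>G i\<^esub> m)) \<longlongrightarrow>
    met_ultranorm nm U ((null_seqs G nm U #>\<^bsub>P\<^esub> g) [^]\<^bsub>met_ultraproduct G nm U\<^esub> (m::nat))) U"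
proof -
  interpret P: group P by (rule group_P)
  interpret N: normal "null_seqs G nm U" P by (rule null_normal)
  have "(null_seqs G nm U #>\<^bsub>P\<^esub> g) [^]\<^bsub>met_ultraproduct G nm U\<^esub> m =
      null_seqs G nm U #>\<^bsub>P\<^esub> (g [^]\<^bsub>P\<^esub> m)"
    unfolding met_ultraproduct_def by (rule N.FactGroup_pow[OF assms])
  then show ?thesis
    using met_ultranorm_coset[OF P.nat_pow_closed[OF assms, of m]]
    by (simp add: nat_pow_product_group)
qed

end

theorem corollary3p6:
  fixes G :: "nat \<Rightarrow> ('a, 'b) monoid_scheme"
    and nm :: "nat \<Rightarrow> 'a \<Rightarrow> ennreal"
    and U :: "nat filter"
    and \<epsilon> :: real
  assumes "\<And>n. metric_group (G n) (nm n)"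
    and "Sup {nm n g | n g. g \<in> carrier (G n)} < \<infinity>"
    and "nonprincipal_ultrafilter U"
    and "\<epsilon> > 0"
    and "torsion_upto \<epsilon> (met_ultraproduct G nm U) (met_ultranorm nm U)"
  shows "almost_uniformly_torsion_upto (2 * \<epsilon>) (met_ultraproduct G nm U) (met_ultranorm nm U)"
proof (rule ccontr)
  have uf: "ultrafilter U"
    using assms(3) by (simp add: nonprincipal_ultrafilter_def)
  interpret metric_group_family G nm U
    by (rule metric_group_family.intro[OF assms(1) uf])
  have nb: "U \<noteq> bot" using uf by (simp add: ultrafilter_def)
  have less: "ennreal \<epsilon> < ennreal (2 * \<epsilon>)" using assms(4) by (simp add: ennreal_less_iff)
  assume not_unif: "\<not> ?thesis"
  \<comment> \<open>A limit of at least \<open>2 * \<epsilon>\<close> lies strictly above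
    \<open>\<epsilon>\<close>, so coordinates exceed \<open>\<epsilon>\<close> along
    \<open>U\<close>. Condition \<open>m\<close> concerns the exponent \<open>Suc m\<close>, which
    leaves out the trivial power.\<close>
  have fin: "eventually (\<lambda>n. \<exists>x\<in>carrier (G n). \<forall>m<N. ennreal \<epsilon> < nm n (x [^]\<^bsub>G n\<^esub> Suc m)) U" for N
  proof -
    \<comment> \<open>The bound \<open>Suc N\<close> is used because a uniform exponent bound must
      be at least 1, while \<open>N\<close> may be 0.\<close>
    obtain X where X: "X \<in> carrier (met_ultraproduct G nm U)"
      and big: "\<And>m. 1 \<le> m \<Longrightarrow> m \<le> Suc N \<Longrightarrow>
        ennreal (2 * \<epsilon>) \<le> met_ultranorm nm U (X [^]\<^bsub>met_ultraproduct G nm U\<^esub> m)"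
      using not_unif unfolding almost_uniformly_torsion_upto_def
      by (metis not_less le_add1 plus_1_eq_Suc)
    obtain g where g: "g \<in> carrier P" and Xg: "X = null_seqs G nm U #>\<^bsub>P\<^esub> g"
      using X by (rule met_ultraproduct_carrierE)
    have "eventually (\<lambda>n. \<forall>m\<in>{..<N}. ennreal \<epsilon> < nm n (g n [^]\<^bsub>G n\<^esub> Suc m)) U"
    proof (intro eventually_ball_finite ballI)
      fix m assume "m \<in> {..<N}"
      then have "ennreal \<epsilon> < met_ultranorm nm U (X [^]\<^bsub>met_ultraproduct G nm U\<^esub> Suc m)"
        using less big[of "Suc m"] by (intro less_le_trans[OF less]) auto
      then show "eventually (\<lambda>n. ennreal \<epsilon> < nm n (g n [^]\<^bsub>G n\<^esub> Suc m)) U"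
        unfolding Xg by (rule order_tendstoD(1)[OF met_ultranorm_pow_tendsto[OF g]])
    qed simp
    then show ?thesis
      by (rule eventually_mono) (use g in \<open>auto intro!: bexI[of _ "g _"]\<close>)
  qed
  have "carrier (G n) \<noteq> {}" for n
    using group.is_monoid[OF grp] monoid.one_closed by blast
  from countable_saturation[OF nonprincipal_ultrafilter_eventually_ge[OF assms(3)] this fin]
  obtain x where x: "\<And>n. x n \<in> carrier (G n)"
    and big: "\<And>m. eventually (\<lambda>n. ennreal \<epsilon> < nm n (x n [^]\<^bsub>G n\<^esub> Suc m)) U"
    by blast
  have xP: "x \<in> carrier P" using x by (simp add: PiE_UNIV_domain)
  obtain N :: nat where "1 \<le> N"
    and small: "met_ultranorm nm U
      ((null_seqs G nm U #>\<^bsub>P\<^esub> x) [^]\<^bsub>met_ultraproduct G nm U\<^esub> N) < ennreal \<epsilon>"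
    using assms(5) met_ultraproduct_carrierI[OF xP] unfolding torsion_upto_def by blast
  then obtain m where N: "N = Suc m" by (cases N) auto
  \<comment> \<open>Torsion makes this one limit strictly less than \<open>\<epsilon>\<close>, hence
    also the coordinates along \<open>U\<close>, against \<open>big\<close>.\<close>
  have "eventually (\<lambda>n. nm n (x n [^]\<^bsub>G n\<^esub> Suc m) < ennreal \<epsilon>) U"
    using order_tendstoD(2)[OF met_ultranorm_pow_tendsto[OF xP] small] by (simp add: N)
  with big[of m] have "eventually (\<lambda>n. False) U" by eventually_elim auto
  then show False using nb by (simp add: eventually_False)
qed

end
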